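(* Let $V,V'$ be Lie superalgebras over a field $K$ and let $\phi:V\to V'$ be a surjective anti-homomorphism of Lie superalgebras. If $A=(\lambda_A,\rho_A)$ is an anti-CIF Lie sub-superalgebra (respectively an anti-CIF ideal) of $V$, then the CIF set $\phi(A)$ of $V'$ is also an anti-CIF Lie sub-superalgebra (respectively an anti-CIF ideal) of $V'$.
   Context: Complex numbers in the closed unit disk are written $\alpha e^{i2\pi\beta}$ with $\alpha,\beta\in[0,1]$ and are handled through the pair $(\alpha,\beta)$: $\alpha e^{i2\pi\beta}\le\gamma e^{i2\pi\delta}$ means $\alpha\le\gamma$ and $\beta\le\delta$. The symbols $\wedge$ (min), $\vee$ (max), $\sup$, $\inf$ are taken componentwise on such pairs. The value $1$ stands for $1e^{i2\pi\cdot 1}$ and $0$ for $0e^{i2\pi\cdot 0}$. A complex intuitionistic fuzzy (CIF) set on a nonempty set $X$ is a pair $A=(\lambda_A,\rho_A)$ of functions $\lambda_A(x)=r_A(x)e^{i2\pi\omega_A(x)}$, $\rho_A(x)=\hat r_A(x)e^{i2\pi\hat\omega_A(x)}$ with $r_A,\omega_A,\hat r_A,\hat\omega_A:X\to[0,1]$ and $r_A(x)+\hat r_A(x)\le 1$ for all $x$. A CIF set $A$ on a $K$-vector space $V$ is a CIF vector subspace of $V$ if for all $x,y\in V$, $\alpha\in K$: $\lambda_A(x+y)\ge\lambda_A(x)\wedge\lambda_A(y)$, $\rho_A(x+y)\le\rho_A(x)\vee\rho_A(y)$, $\lambda_A(\alpha x)\ge\lambda_A(x)$, $\rho_A(\alpha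 x)\le\rho_A(x)$; moreover it is always assumed that $\lambda_A(0)=1$ and $\rho_A(0)=0$. A Lie superalgebra over $K$ is a $\mathbb{Z}_2$-graded vector space $V=V_0+V_1$ (direct sum) with a bilinear bracket $[\,,]:V\times V\to V$ such that $[V_i,V_j]\subseteq V_{i+j}$; $[x,y]=-(-1)^{|x||y|}[y,x]$; and $[x,[y,z]]-(-1)^{|x||y|}[y,[x,z]]=[[x,y],z]$ for homogeneous elements. Given CIF vector subspaces $A_j$ of $V_j$ ($j=0,1$), let $\mathfrak a_j$ be the extension of $A_j$ to $V$: $\lambda_{\mathfrak a_j}=\lambda_{A_j}$, $\rho_{\mathfrak a_j}=\rho_{A_j}$ on $V_j$, and $\lambda_{\mathfrak a_j}=0$, $\rho_{\mathfrak a_j}=1$ off $V_j$. Then $A_0\oplus A_1$ denotes the CIF set $\mathfrak a_0+\mathfrak a_1$ on $V$ given by $\lambda(x)=\sup_{x=a+b}\{\lambda_{\mathfrak a_0}(a)\wedge\lambda_{\mathfrak a_1}(b)\}$, $\rho(x)=\inf_{x=a+b}\{\rho_{\mathfrak a_0}(a)\vee\rho_{\mathfrak a_1}(b)\}$. A CIF vector subspace $A$ of $V$ is $\mathbb{Z}_2$-graded if $A=A_0\oplus A_1$ for some such $A_0,A_1$. A CIF set $A$ of $V$ is an anti-CIF Lie sub-superalgebra of $V$ if it is a $\mathbb{Z}_2$-graded CIF vector subspace of $V$ and $\lambda_A(-[x,y])\ge\lambda_A(x)\wedge\lambda_A(y)$, $\rho_A(-[x,y])\le\rho_A(x)\vee\rho_A(y)$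 for all $x,y\in V$. It is an anti-CIF ideal of $V$ if it is a $\mathbb{Z}_2$-graded CIF vector subspace of $V$ and $\lambda_A(-[x,y])\ge\lambda_A(x)\vee\lambda_A(y)$, $\rho_A(-[x,y])\le\rho_A(x)\wedge\rho_A(y)$ for all $x,y\in V$. An anti-homomorphism of Lie superalgebras $\phi:V\to V'$ is a linear map with $\phi(V_\alpha)\subseteq V'_\alpha$ for $\alpha=0,1$ and $\phi([x,y])=-[\phi(x),\phi(y)]$ for all $x,y\in V$. The image $\phi(A)$ of a CIF set $A$ of $V$ is the CIF set of $V'$ with $\lambda_{\phi(A)}(y)=\sup_{x\in\phi^{-1}(y)}\lambda_A(x)$ and $\rho_{\phi(A)}(y)=\inf_{x\in\phi^{-1}(y)}\rho_A(x)$ for $y\in\phi(V)$ (componentwise sup and inf), and $\lambda_{\phi(A)}(y)=0$, $\rho_{\phi(A)}(y)=1$ for $y\notin\phi(V)$. *)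

theory Defs
  imports Complex_Main "HOL-Library.Product_Order"
begin

text \<open>
  A value \<open>\<alpha> exp (2\<pi>i\<beta>)\<close> of the closed unit disk, with \<open>\<alpha>, \<beta>\<close> in the unit interval, is represented by
  the pair \<open>(\<alpha>, \<beta>)\<close>.  The type \<^typ>\<open>complex\<close> would not do: \<open>\<beta> = 0\<close> and \<open>\<beta> = 1\<close> (and all \<open>\<beta>\<close> when
  \<open>\<alpha> = 0\<close>) give the same complex number but are distinguished by the order.  With
  \<^theory>\<open>HOL-Library.Product_Order\<close>, the operations \<open>\<le>\<close>, \<^const>\<open>inf\<close>, \<^const>\<open>sup\<close>, \<^const>\<open>Inf\<close>, \<^const>\<open>Sup\<close>
  on pairs are componentwise.
\<close>

type_synonym cval = "real \<times> real"

definition cval_zero :: cval where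
  "cval_zero = (0, 0)"

definition cval_one :: cval where
  "cval_one = (1, 1)"

text \<open>
  Only the values on the carrier \<open>X\<close> of a CIF set on \<open>X\<close> are meaningful.
\<close>

record 'a cif =
  lam :: "'a \<Rightarrow> cval"
  rho :: "'a \<Rightarrow> cval"

definition cif_set_on :: "'a set \<Rightarrow> 'a cif \<Rightarrow> bool" where
  "cif_set_on X A \<longleftrightarrow>
     (\<forall>x\<in>X. cval_zero \<le> lam A x \<and> lam A x \<le> cval_one \<and>
            cval_zero \<le> rho A x \<and> rho A x \<le> cval_one \<and>
            fst (lam A x) + fst (rho A x) \<le> 1)"

text \<open>CIF vector subspaces of the vector space \<open>U\<close>, itself a linear subspace of the ambient type.\<close>

definition cif_subspace ::
  "('k::field \<Rightarrow> 'v::ab_group_add \<Rightarrow> 'v) \<Rightarrow> 'v set \<Rightarrow> 'v cif \<Rightarrow> bool" where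
  "cif_subspace scale U A \<longleftrightarrow>
     cif_set_on U A \<and>
     (\<forall>x\<in>U. \<forall>y\<in>U. lam A (x + y) \<ge> inf (lam A x) (lam A y) \<and>
                  rho A (x + y) \<le> sup (rho A x) (rho A y)) \<and>
     (\<forall>c. \<forall>x\<in>U. lam A (scale c x) \<ge> lam A x \<and> rho A (scale c x) \<le> rho A x) \<and>
     lam A 0 = cval_one \<and> rho A 0 = cval_zero"

text \<open>
  The grading is \<open>G 0\<close>, \<open>G 1\<close>; other indices are irrelevant.  The zero vector is homogeneous of both
  degrees.
\<close>

locale lie_superalgebra = vector_space scale
  for scale :: "'k::field \<Rightarrow> 'v::ab_group_add \<Rightarrow> 'v" +
  fixes G :: "nat \<Rightarrow> 'v set"
    and br :: "'v \<Rightarrow> 'v \<Rightarrow> 'v"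
  assumes grade_subspace: "i < 2 \<Longrightarrow> subspace (G i)"
    and grade_sum: "{a + b | a b. a \<in> G 0 \<and> b \<in> G 1} = UNIV"
    and grade_direct: "G 0 \<inter> G 1 = {0}"
    and br_linear_right: "Vector_Spaces.linear scale scale (\<lambda>y. br x y)"
    and br_linear_left: "Vector_Spaces.linear scale scale (\<lambda>x. br x y)"
    and br_grade: "\<lbrakk>i < 2; j < 2; x \<in> G i; y \<in> G j\<rbrakk> \<Longrightarrow> br x y \<in> G ((i + j) mod 2)"
    and br_skew: "\<lbrakk>i < 2; j < 2; x \<in> G i; y \<in> G j\<rbrakk> \<Longrightarrow>
      br x y = - scale ((- 1) ^ (i * j)) (br y x)"
    and br_jacobi: "\<lbrakk>i < 2; j < 2; k < 2; x \<in> G i; y \<in> G j; z \<in> G k\<rbrakk> \<Longrightarrow>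
      br x (br y z) - scale ((- 1) ^ (i * j)) (br y (br x z)) = br (br x y) z"

definition cif_extend :: "'v set \<Rightarrow> 'v cif \<Rightarrow> 'v cif" where
  "cif_extend U A =
     \<lparr> lam = (\<lambda>x. if x \<in> U then lam A x else cval_zero),
       rho = (\<lambda>x. if x \<in> U then rho A x else cval_one) \<rparr>"

text \<open>
  The sets in \<^const>\<open>Sup\<close> and \<^const>\<open>Inf\<close> below are nonempty, and bounded when \<open>B\<close>, \<open>C\<close> are CIF sets.
\<close>

definition cif_sum :: "'v::ab_group_add cif \<Rightarrow> 'v cif \<Rightarrow> 'v cif" where
  "cif_sum B C =
     \<lparr> lam = (\<lambda>x. Sup {inf (lam B a) (lam C b) | a b. x = a + b}),
       rho = (\<lambda>x. Inf {sup (rho B a) (rho C b) | a b. x = a + b}) \<rparr>"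

definition graded_cif_subspace ::
  "('k::field \<Rightarrow> 'v::ab_group_add \<Rightarrow> 'v) \<Rightarrow> (nat \<Rightarrow> 'v set) \<Rightarrow> 'v cif \<Rightarrow> bool" where
  "graded_cif_subspace scale G A \<longleftrightarrow>
     cif_subspace scale UNIV A \<and>
     (\<exists>A0 A1. cif_subspace scale (G 0) A0 \<and> cif_subspace scale (G 1) A1 \<and>
              A = cif_sum (cif_extend (G 0) A0) (cif_extend (G 1) A1))"

definition anti_cif_lie_subsuperalgebra ::
  "('k::field \<Rightarrow> 'v::ab_group_add \<Rightarrow> 'v) \<Rightarrow> (nat \<Rightarrow> 'v set) \<Rightarrow> ('v \<Rightarrow> 'v \<Rightarrow> 'v) \<Rightarrow> 'v cif \<Rightarrow> bool"
  where
  "anti_cif_lie_subsuperalgebra scale G br A \<longleftrightarrow>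
     graded_cif_subspace scale G A \<and>
     (\<forall>x y. lam A (- br x y) \<ge> inf (lam A x) (lam A y) \<and>
            rho A (- br x y) \<le> sup (rho A x) (rho A y))"

definition anti_cif_ideal ::
  "('k::field \<Rightarrow> 'v::ab_group_add \<Rightarrow> 'v) \<Rightarrow> (nat \<Rightarrow> 'v set) \<Rightarrow> ('v \<Rightarrow> 'v \<Rightarrow> 'v) \<Rightarrow> 'v cif \<Rightarrow> bool"
  where
  "anti_cif_ideal scale G br A \<longleftrightarrow>
     graded_cif_subspace scale G A \<and>
     (\<forall>x y. lam A (- br x y) \<ge> sup (lam A x) (lam A y) \<and>
            rho A (- br x y) \<le> inf (rho A x) (rho A y))"

definition lie_super_anti_hom ::
  "('k::field \<Rightarrow> 'v::ab_group_add \<Rightarrow> 'v) \<Rightarrow> (nat \<Rightarrow> 'v set) \<Rightarrow> ('v \<Rightarrow> 'v \<Rightarrow> 'v) \<Rightarrow>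
   ('k \<Rightarrow> 'w::ab_group_add \<Rightarrow> 'w) \<Rightarrow> (nat \<Rightarrow> 'w set) \<Rightarrow> ('w \<Rightarrow> 'w \<Rightarrow> 'w) \<Rightarrow> ('v \<Rightarrow> 'w) \<Rightarrow> bool"
  where
  "lie_super_anti_hom scale G br scale' G' br' \<phi> \<longleftrightarrow>
     Vector_Spaces.linear scale scale' \<phi> \<and>
     (\<forall>i<2. \<phi> ` G i \<subseteq> G' i) \<and>
     (\<forall>x y. \<phi> (br x y) = - br' (\<phi> x) (\<phi> y))"

definition cif_image :: "('v \<Rightarrow> 'w) \<Rightarrow> 'v cif \<Rightarrow> 'w cif" where
  "cif_image \<phi> A =
     \<lparr> lam = (\<lambda>y. if y \<in> range \<phi> then (SUP x\<in>\<phi> -` {y}. lam A x) else cval_zero),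
       rho = (\<lambda>y. if y \<in> range \<phi> then (INF x\<in>\<phi> -` {y}. rho A x) else cval_one) \<rparr>"

end

theory Submission imports Defs begin

text \<open>
  A CIF subspace \<open>A\<close> is graded iff passing to homogeneous components can only improve the values:
  \<open>lam A (a + b) \<le> inf (lam A a) (lam A b)\<close> and dually for \<open>rho\<close>; then \<open>A\<close> restricted to \<open>G 0\<close> and \<open>G 1\<close>
  serves as the two summands.  In this form gradedness, like the other defining inequalities, passes
  to the image by taking suprema and infima over the fibres of \<open>\<phi>\<close>.
\<close>

text \<open>
  In the next two lemmas a pointwise bound passes to suprema because each component is linearly
  ordered; a general lattice lacks the infinite distributive law this needs.
\<close>

lemma inf_Sup_le_cval:
  fixes u :: cval
  assumes "S \<noteq> {}" "bdd_above S" "T \<noteq> {}" "bdd_above T"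
    and le: "\<And>s t. s \<in> S \<Longrightarrow> t \<in> T \<Longrightarrow> inf s t \<le> u"
  shows "inf (Sup S) (Sup T) \<le> u"
proof -
  \<comment> \<open>The bound is proved for one real component \<open>p\<close>, later
    \<open>fst\<close> and \<open>snd\<close>. If \<open>p u\<close> lay below both suprema, some
    \<open>s\<close> and \<open>t\<close> would exceed it, and so would the minimum, which is one of
    \<open>p s\<close> and \<open>p t\<close>.\<close>
  have *: "min (Sup (p ` S)) (Sup (p ` T)) \<le> p u"
    if bdd: "bdd_above (p ` S)" "bdd_above (p ` T)"
      and p: "\<And>s t. s \<in> S \<Longrightarrow> t \<in> T \<Longrightarrow> min (p s) (p t) \<le> p u" for p :: "cval \<Rightarrow> real"
  proof (rule ccontr)
    assume "\<not> ?thesis"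
    then have "p u < Sup (p ` S)" "p u < Sup (p ` T)" by auto
    then obtain s t where "s \<in> S" "p u < p s" "t \<in> T" "p u < p t"
      using assms(1,3) bdd by (auto simp: less_cSup_iff)
    then show False using p[of s t] by auto
  qed
  obtain M N where M: "\<And>s. s \<in> S \<Longrightarrow> s \<le> M" and N: "\<And>t. t \<in> T \<Longrightarrow> t \<le> N"
    using assms(2,4) unfolding bdd_above_def by metis
  have "bdd_above (fst ` S)" "bdd_above (fst ` T)" "bdd_above (snd ` S)" "bdd_above (snd ` T)"
    using M N by (auto intro!: bdd_aboveI2 simp: less_eq_prod_def)
  then show ?thesis
    using *[of fst] *[of snd] le by (simp add: less_eq_prod_def fst_Sup snd_Sup inf_min)
qed

lemma le_sup_Inf_cval:
  fixes u :: cval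
  assumes "S \<noteq> {}" "bdd_below S" "T \<noteq> {}" "bdd_below T"
    and le: "\<And>s t. s \<in> S \<Longrightarrow> t \<in> T \<Longrightarrow> u \<le> sup s t"
  shows "u \<le> sup (Inf S) (Inf T)"
proof -
  have *: "p u \<le> max (Inf (p ` S)) (Inf (p ` T))"
    if bdd: "bdd_below (p ` S)" "bdd_below (p ` T)"
      and p: "\<And>s t. s \<in> S \<Longrightarrow> t \<in> T \<Longrightarrow> p u \<le> max (p s) (p t)" for p :: "cval \<Rightarrow> real"
  proof (rule ccontr)
    assume "\<not> ?thesis"
    then have "Inf (p ` S) < p u" "Inf (p ` T) < p u" by auto
    then obtain s t where "s \<in> S" "p s < p u" "t \<in> T" "p t < p u"
      using assms(1,3) bdd by (auto simp: cInf_less_iff)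
    then show False using p[of s t] by auto
  qed
  obtain M N where M: "\<And>s. s \<in> S \<Longrightarrow> M \<le> s" and N: "\<And>t. t \<in> T \<Longrightarrow> N \<le> t"
    using assms(2,4) unfolding bdd_below_def by metis
  have "bdd_below (fst ` S)" "bdd_below (fst ` T)" "bdd_below (snd ` S)" "bdd_below (snd ` T)"
    using M N by (auto intro!: bdd_belowI2 simp: less_eq_prod_def)
  then show ?thesis
    using *[of fst] *[of snd] le by (simp add: less_eq_prod_def fst_Inf snd_Inf sup_max)
qed

section \<open>Images of CIF sets under a surjection\<close>

context
  fixes \<phi> :: "'v \<Rightarrow> 'w" and A :: "'v cif"
  assumes surj: "surj \<phi>" and cif: "cif_set_on UNIV A"
begin

text \<open>Surjectivity makes the default branch of \<open>cif_image\<close> vacuous, so the values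
  are plain suprema and infima over fibres.\<close>

lemma lam_cif_image: "lam (cif_image \<phi> A) y = Sup (lam A ` (\<phi> -` {y}))"
  and rho_cif_image: "rho (cif_image \<phi> A) y = Inf (rho A ` (\<phi> -` {y}))"
  using surj by (simp_all add: cif_image_def)

lemma fibre_nonempty: "f ` (\<phi> -` {y}) \<noteq> {}"
  using surj_vimage_empty[OF surj, of "{y}"] by simp

text \<open>Real suprema and infima behave only on nonempty bounded sets; the bounds come from the
  CIF values lying between 0 and 1.\<close>

lemma bdd_above_lam: "bdd_above (lam A ` S)"
  using cif by (auto simp: cif_set_on_def intro!: bdd_aboveI2)

lemma bdd_below_rho: "bdd_below (rho A ` S)"
  using cif by (auto simp: cif_set_on_def intro!: bdd_belowI2)

lemma lam_le_image: "lam A x \<le> lam (cif_image \<phi> A) (\<phi> x)"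
  unfolding lam_cif_image by (rule cSup_upper[OF _ bdd_above_lam]) simp

lemma rho_image_le: "rho (cif_image \<phi> A) (\<phi> x) \<le> rho A x"
  unfolding rho_cif_image by (rule cInf_lower[OF _ bdd_below_rho]) simp

lemma lam_image_least:
  assumes "\<And>x. \<phi> x = y \<Longrightarrow> lam A x \<le> u"
  shows "lam (cif_image \<phi> A) y \<le> u"
  unfolding lam_cif_image by (rule cSup_least[OF fibre_nonempty]) (use assms in auto)

lemma rho_image_greatest:
  assumes "\<And>x. \<phi> x = y \<Longrightarrow> u \<le> rho A x"
  shows "u \<le> rho (cif_image \<phi> A) y"
  unfolding rho_cif_image by (rule cInf_greatest[OF fibre_nonempty]) (use assms in auto)

text \<open>Used when both arguments of an inequality vary: the preimages \<open>a\<close> and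
  \<open>b\<close> run independently through their fibres, so the pointwise bound must hold for
  every pair.\<close>

lemma inf_lam_image_least:
  assumes "\<And>a b. \<phi> a = y \<Longrightarrow> \<phi> b = z \<Longrightarrow> inf (lam A a) (lam A b) \<le> u"
  shows "inf (lam (cif_image \<phi> A) y) (lam (cif_image \<phi> A) z) \<le> u"
  unfolding lam_cif_image
  by (rule inf_Sup_le_cval[OF fibre_nonempty bdd_above_lam fibre_nonempty bdd_above_lam])
    (use assms in auto)

lemma sup_rho_image_greatest:
  assumes "\<And>a b. \<phi> a = y \<Longrightarrow> \<phi> b = z \<Longrightarrow> u \<le> sup (rho A a) (rho A b)"
  shows "u \<le> sup (rho (cif_image \<phi> A) y) (rho (cif_image \<phi> A) z)"
  unfolding rho_cif_image
  by (rule le_sup_Inf_cval[OF fibre_nonempty bdd_below_rho fibre_nonempty bdd_below_rho])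
    (use assms in auto)

lemma cif_set_on_image: "cif_set_on UNIV (cif_image \<phi> A)"
proof -
  let ?B = "cif_image \<phi> A"
  have "cval_zero \<le> lam ?B y \<and> lam ?B y \<le> cval_one \<and>
      cval_zero \<le> rho ?B y \<and> rho ?B y \<le> cval_one \<and> fst (lam ?B y) + fst (rho ?B y) \<le> 1" for y
  proof -
    have A: "cval_zero \<le> lam A x" "lam A x \<le> cval_one" "cval_zero \<le> rho A x" "rho A x \<le> cval_one"
      "fst (lam A x) + fst (rho A x) \<le> 1" for x
      using cif by (auto simp: cif_set_on_def)
    obtain x where x: "\<phi> x = y" using surj by (metis surjD)
    \<comment> \<open>The supremum and the infimum may be approached at different points of the
      fibre, so the constraint on their sum is recast as an upper bound for \<open>lam\<close>. At
      each \<open>a\<close> in the fibre, \<open>fst (lam A a)\<close> is at most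
      \<open>1 - fst (rho A a)\<close>, hence at most \<open>1 - fst (rho ?B y)\<close>. The second
      component 1 is the trivial bound.\<close>
    have "lam ?B y \<le> (1 - fst (rho ?B y), 1)"
    proof (rule lam_image_least)
      fix a assume a: "\<phi> a = y"
      then show "lam A a \<le> (1 - fst (rho ?B y), 1)"
        using rho_image_le[of a] A(2,5)[of a] by (auto simp: less_eq_prod_def cval_one_def)
    qed
    then have "fst (lam ?B y) + fst (rho ?B y) \<le> 1" by (simp add: less_eq_prod_def)
    moreover have "cval_zero \<le> lam ?B y" "rho ?B y \<le> cval_one"
      using order_trans[OF A(1) lam_le_image[of x]] order_trans[OF rho_image_le[of x] A(4)] x by simp_all
    ultimately show ?thesis
      using A(2,3) by (auto intro: lam_image_least rho_image_greatest)
  qed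
  then show ?thesis by (simp add: cif_set_on_def)
qed

end

section \<open>CIF subspaces and their images\<close>

lemma cif_subspace_subset:
  "cif_subspace scale U A \<Longrightarrow> W \<subseteq> U \<Longrightarrow> cif_subspace scale W A"
  by (auto simp: cif_subspace_def cif_set_on_def subset_iff)

lemma cif_subspace_image:
  assumes lin: "Vector_Spaces.linear scale scale' \<phi>" and surj: "surj \<phi>"
    and A: "cif_subspace scale UNIV A"
  shows "cif_subspace scale' UNIV (cif_image \<phi> A)"
proof -
  interpret phi: Vector_Spaces.linear scale scale' \<phi> by fact
  have cif: "cif_set_on UNIV A"
    and add: "\<And>x y. inf (lam A x) (lam A y) \<le> lam A (x + y)"
      "\<And>x y. rho A (x + y) \<le> sup (rho A x) (rho A y)"
    and scl: "\<And>c x. lam A x \<le> lam A (scale c x)" "\<And>c x. rho A (scale c x) \<le> rho A x"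
    and zero: "lam A 0 = cval_one" "rho A 0 = cval_zero"
    using A by (auto simp: cif_subspace_def)
  let ?B = "cif_image \<phi> A"
  have cifB: "cif_set_on UNIV ?B" by (rule cif_set_on_image[OF surj cif])
  note upper = lam_le_image[OF surj cif] and lower = rho_image_le[OF surj cif]
  \<comment> \<open>For any choice of preimages \<open>a\<close> and \<open>b\<close>, linearity
    puts \<open>a + b\<close> in the fibre over \<open>\<phi> a + \<phi> b\<close>. Scalar multiples
    are treated alike.\<close>
  have "inf (lam A a) (lam A b) \<le> lam ?B (\<phi> a + \<phi> b)"
    "rho ?B (\<phi> a + \<phi> b) \<le> sup (rho A a) (rho A b)" for a b
    using order_trans[OF add(1) upper] order_trans[OF lower add(2)] by (simp_all flip: phi.add)
  then have "inf (lam ?B x) (lam ?B y) \<le> lam ?B (x + y)"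
    "rho ?B (x + y) \<le> sup (rho ?B x) (rho ?B y)" for x y
    by (blast intro: inf_lam_image_least[OF surj cif] sup_rho_image_greatest[OF surj cif])+
  moreover have "lam A a \<le> lam ?B (scale' c (\<phi> a))" "rho ?B (scale' c (\<phi> a)) \<le> rho A a" for c a
    using order_trans[OF scl(1) upper] order_trans[OF lower scl(2)] by (simp_all flip: phi.scale)
  then have "lam ?B x \<le> lam ?B (scale' c x)" "rho ?B (scale' c x) \<le> rho ?B x" for c x
    by (blast intro: lam_image_least[OF surj cif] rho_image_greatest[OF surj cif])+
  \<comment> \<open>Since 0 lies in its own fibre, the image values at 0 are at least as extreme as
    those of \<open>A\<close>, which are already the extreme ones.\<close>
  moreover have "lam ?B 0 = cval_one" "rho ?B 0 = cval_zero"
    using upper[of 0] lower[of 0] cifB zero phi.zero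
    by (auto simp: cif_set_on_def intro: antisym)
  ultimately show ?thesis using cifB by (simp add: cif_subspace_def)
qed

section \<open>Gradedness and its passage to images\<close>

context lie_superalgebra
begin

lemma zero_in_grade: "i < 2 \<Longrightarrow> 0 \<in> G i"
  using grade_subspace subspace_0 by blast

lemma grade_decomp: obtains a b where "a \<in> G 0" "b \<in> G 1" "x = a + b"
  using grade_sum by blast

lemma grade_unique:
  assumes "a \<in> G 0" "a' \<in> G 0" "b \<in> G 1" "b' \<in> G 1" "a + b = a' + b'"
  shows "a = a'" "b = b'"
proof -
  have "a - a' = b' - b" using assms(5) by (simp add: algebra_simps)
  moreover have "a - a' \<in> G 0" "b' - b \<in> G 1"
    using assms subspace_diff[OF grade_subspace] by auto
  ultimately have "a - a' = 0" "b' - b = 0" using grade_direct by (metis IntI singletonD)+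
  then show "a = a'" "b = b'" by auto
qed

text \<open>The supremum is a maximum: \<open>a + b\<close> has only one decomposition into
  homogeneous components, and in any other decomposition some summand is off its grade, so the
  extension contributes the worst value, 0 for \<open>lam\<close> and 1 for
  \<open>rho\<close>.\<close>

lemma cif_direct_sum_apply:
  assumes "cif_set_on (G 0) B" "cif_set_on (G 1) C" and a: "a \<in> G 0" and b: "b \<in> G 1"
  shows "lam (cif_sum (cif_extend (G 0) B) (cif_extend (G 1) C)) (a + b) = inf (lam B a) (lam C b)"
    (is "?L = ?l")
    and "rho (cif_sum (cif_extend (G 0) B) (cif_extend (G 1) C)) (a + b) = sup (rho B a) (rho C b)"
    (is "?R = ?r")
proof -
  let ?B = "cif_extend (G 0) B" and ?C = "cif_extend (G 1) C"
  let ?S = "{inf (lam ?B a') (lam ?C b') | a' b'. a + b = a' + b'}"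
  let ?T = "{sup (rho ?B a') (rho ?C b') | a' b'. a + b = a' + b'}"
  have bounds: "cval_zero \<le> lam B x" "rho B x \<le> cval_one" if "x \<in> G 0" for x
    using assms(1) that by (auto simp: cif_set_on_def)
  have bounds': "cval_zero \<le> lam C x" "rho C x \<le> cval_one" if "x \<in> G 1" for x
    using assms(2) that by (auto simp: cif_set_on_def)
  have uniq: "a' = a \<and> b' = b" if "a + b = a' + b'" "a' \<in> G 0" "b' \<in> G 1" for a' b'
    using grade_unique[of a a' b b'] a b that by simp
  have "?l = inf (lam ?B a) (lam ?C b)" "?r = sup (rho ?B a) (rho ?C b)"
    using a b by (simp_all add: cif_extend_def)
  then have "?l \<in> ?S" "?r \<in> ?T" by blast+
  moreover have "inf (lam ?B a') (lam ?C b') \<le> ?l" if "a + b = a' + b'" for a' b'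
  proof (cases "a' \<in> G 0 \<and> b' \<in> G 1")
    case True
    then show ?thesis using uniq[OF that] by (simp add: cif_extend_def)
  next
    case False
    then have "inf (lam ?B a') (lam ?C b') \<le> cval_zero" by (auto simp: cif_extend_def)
    also have "cval_zero \<le> ?l" using bounds(1)[OF a] bounds'(1)[OF b] by simp
    finally show ?thesis .
  qed
  moreover have "?r \<le> sup (rho ?B a') (rho ?C b')" if "a + b = a' + b'" for a' b'
  proof (cases "a' \<in> G 0 \<and> b' \<in> G 1")
    case True
    then show ?thesis using uniq[OF that] by (simp add: cif_extend_def)
  next
    case False
    have "?r \<le> cval_one" using bounds(2)[OF a] bounds'(2)[OF b] by simp
    also have "cval_one \<le> sup (rho ?B a') (rho ?C b')" using False by (auto simp: cif_extend_def)
    finally show ?thesis .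
  qed
  ultimately have "Sup ?S = ?l" "Inf ?T = ?r"
    by (blast intro: cSup_eq_maximum cInf_eq_minimum)+
  then show "?L = ?l" "?R = ?r" by (simp_all add: cif_sum_def)
qed

text \<open>This replaces the existential over summands by inequalities on \<open>A\<close> alone,
  which can be checked at each point of a fibre.\<close>

lemma graded_cif_subspace_iff:
  "graded_cif_subspace scale G A \<longleftrightarrow>
     cif_subspace scale UNIV A \<and>
     (\<forall>a\<in>G 0. \<forall>b\<in>G 1. lam A (a + b) \<le> inf (lam A a) (lam A b) \<and>
                         sup (rho A a) (rho A b) \<le> rho A (a + b))"
  (is "_ \<longleftrightarrow> _ \<and> ?hom")
proof
  assume "graded_cif_subspace scale G A"
  then obtain B C where A: "cif_subspace scale UNIV A"
    and B: "cif_subspace scale (G 0) B" and C: "cif_subspace scale (G 1) C"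
    and eq: "A = cif_sum (cif_extend (G 0) B) (cif_extend (G 1) C)"
    by (auto simp: graded_cif_subspace_def)
  have cif: "cif_set_on (G 0) B" "cif_set_on (G 1) C"
    and zero: "lam B 0 = cval_one" "rho B 0 = cval_zero" "lam C 0 = cval_one" "rho C 0 = cval_zero"
    using B C by (auto simp: cif_subspace_def)
  have sum: "lam A (a + b) = inf (lam B a) (lam C b)" "rho A (a + b) = sup (rho B a) (rho C b)"
    if "a \<in> G 0" "b \<in> G 1" for a b
    using cif_direct_sum_apply[OF cif that] eq by simp_all
  \<comment> \<open>Taking the other component to be 0, where \<open>C\<close> has the values 1 and
    0, shows that \<open>B\<close> is the restriction of \<open>A\<close>.\<close>
  have "lam A a = lam B a" "rho A a = rho B a" if "a \<in> G 0" for a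
    using sum[OF that zero_in_grade] zero cif(1) that
    by (auto simp: cif_set_on_def inf_absorb1 sup_absorb1)
  moreover have "lam A b = lam C b" "rho A b = rho C b" if "b \<in> G 1" for b
    using sum[OF zero_in_grade that] zero cif(2) that
    by (auto simp: cif_set_on_def inf_absorb2 sup_absorb2)
  ultimately show "cif_subspace scale UNIV A \<and> ?hom" using A sum by simp
next
  assume "cif_subspace scale UNIV A \<and> ?hom"
  then have A: "cif_subspace scale UNIV A" and hom: ?hom by auto
  let ?S = "cif_sum (cif_extend (G 0) A) (cif_extend (G 1) A)"
  have sub: "cif_subspace scale (G i) A" for i
    using A by (rule cif_subspace_subset) simp
  then have cif: "cif_set_on (G i) A" for i by (simp add: cif_subspace_def)
  have "lam A x = lam ?S x \<and> rho A x = rho ?S x" for x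
  proof -
    obtain a b where ab: "a \<in> G 0" "b \<in> G 1" "x = a + b" by (rule grade_decomp)
    \<comment> \<open>One inequality is the homogeneity assumption, the other is the subspace
      inequality for sums.\<close>
    have "lam A x = inf (lam A a) (lam A b)" "rho A x = sup (rho A a) (rho A b)"
      using A hom ab by (auto simp: cif_subspace_def intro: antisym)
    then show ?thesis using cif_direct_sum_apply[OF cif cif ab(1,2)] ab(3) by simp
  qed
  then have "A = ?S" by (simp add: cif.equality fun_eq_iff)
  then show "graded_cif_subspace scale G A"
    using A sub unfolding graded_cif_subspace_def by blast
qed

end

text \<open>Any \<open>x\<close> over \<open>a' + b'\<close> splits into homogeneous
  \<open>a\<close> and \<open>b\<close>. As \<open>\<phi>\<close> preserves degree, uniqueness of
  the decomposition in the target forces \<open>\<phi> a = a'\<close> and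
  \<open>\<phi> b = b'\<close>, so the component inequality at \<open>x\<close> is bounded by the
  image values at \<open>a'\<close> and \<open>b'\<close>.\<close>

lemma graded_cif_subspace_image:
  assumes V: "lie_superalgebra scale G br" and W: "lie_superalgebra scale' G' br'"
    and hom: "lie_super_anti_hom scale G br scale' G' br' \<phi>" and surj: "surj \<phi>"
    and A: "graded_cif_subspace scale G A"
  shows "graded_cif_subspace scale' G' (cif_image \<phi> A)"
proof -
  interpret V: lie_superalgebra scale G br by fact
  interpret W: lie_superalgebra scale' G' br' by fact
  have lin: "Vector_Spaces.linear scale scale' \<phi>"
    and grade: "\<And>i x. i < 2 \<Longrightarrow> x \<in> G i \<Longrightarrow> \<phi> x \<in> G' i"
    using hom by (auto simp: lie_super_anti_hom_def)
  interpret phi: Vector_Spaces.linear scale scale' \<phi> by fact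
  have sub: "cif_subspace scale UNIV A"
    and comp: "\<And>a b. a \<in> G 0 \<Longrightarrow> b \<in> G 1 \<Longrightarrow> lam A (a + b) \<le> inf (lam A a) (lam A b)"
      "\<And>a b. a \<in> G 0 \<Longrightarrow> b \<in> G 1 \<Longrightarrow> sup (rho A a) (rho A b) \<le> rho A (a + b)"
    using A V.graded_cif_subspace_iff by auto
  have cif: "cif_set_on UNIV A" using sub by (simp add: cif_subspace_def)
  let ?B = "cif_image \<phi> A"
  have "lam ?B (a' + b') \<le> inf (lam ?B a') (lam ?B b') \<and> sup (rho ?B a') (rho ?B b') \<le> rho ?B (a' + b')"
    if ab': "a' \<in> G' 0" "b' \<in> G' 1" for a' b'
  proof -
    have "lam A x \<le> inf (lam ?B a') (lam ?B b') \<and> sup (rho ?B a') (rho ?B b') \<le> rho A x"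
      if x: "\<phi> x = a' + b'" for x
    proof -
      obtain a b where ab: "a \<in> G 0" "b \<in> G 1" "x = a + b" by (rule V.grade_decomp)
      have "a' + b' = \<phi> a + \<phi> b" using x ab(3) phi.add by simp
      then have "a' = \<phi> a" "b' = \<phi> b"
        using W.grade_unique[OF ab'(1) grade[OF _ ab(1)] ab'(2) grade[OF _ ab(2)]] by simp_all
      then show ?thesis
        using order_trans[OF comp(1)[OF ab(1,2)] inf_mono[OF lam_le_image[OF surj cif] lam_le_image[OF surj cif]]]
          order_trans[OF sup_mono[OF rho_image_le[OF surj cif] rho_image_le[OF surj cif]] comp(2)[OF ab(1,2)]]
          ab(3) by simp
    qed
    then show ?thesis
      by (blast intro: lam_image_least[OF surj cif] rho_image_greatest[OF surj cif])
  qed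
  then show ?thesis
    using cif_subspace_image[OF lin surj sub] W.graded_cif_subspace_iff by blast
qed

section \<open>Anti-CIF Lie sub-superalgebras and ideals\<close>

theorem proposition4p4:
  fixes scale :: "'k::field \<Rightarrow> 'v::ab_group_add \<Rightarrow> 'v"
    and G :: "nat \<Rightarrow> 'v set"
    and br :: "'v \<Rightarrow> 'v \<Rightarrow> 'v"
    and scale' :: "'k \<Rightarrow> 'w::ab_group_add \<Rightarrow> 'w"
    and G' :: "nat \<Rightarrow> 'w set"
    and br' :: "'w \<Rightarrow> 'w \<Rightarrow> 'w"
    and \<phi> :: "'v \<Rightarrow> 'w"
    and A :: "'v cif"
  assumes "lie_superalgebra scale G br"
    and "lie_superalgebra scale' G' br'"
    and "lie_super_anti_hom scale G br scale' G' br' \<phi>"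
    and "surj \<phi>"
  shows "(anti_cif_lie_subsuperalgebra scale G br A \<longrightarrow>
            anti_cif_lie_subsuperalgebra scale' G' br' (cif_image \<phi> A)) \<and>
         (anti_cif_ideal scale G br A \<longrightarrow>
            anti_cif_ideal scale' G' br' (cif_image \<phi> A))"
proof -
  interpret V: lie_superalgebra scale G br by fact
  let ?B = "cif_image \<phi> A"
  \<comment> \<open>The sign of the anti-homomorphism makes \<open>br x y\<close> a preimage of
    \<open>- br' (\<phi> x) (\<phi> y)\<close>, whereas the hypotheses on \<open>A\<close> concern
    \<open>- br x y\<close>; the inequalities \<open>neg\<close> bridge this gap.\<close>
  have br: "- br' (\<phi> x) (\<phi> y) = \<phi> (br x y)" for x y
    using assms(3) by (simp add: lie_super_anti_hom_def)
  note image = graded_cif_subspace_image[OF assms]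
  have cif: "cif_set_on UNIV A"
    and neg: "lam A (- br x y) \<le> lam A (br x y)" "rho A (br x y) \<le> rho A (- br x y)"
    if A: "graded_cif_subspace scale G A" for x y
  proof -
    have sub: "cif_subspace scale UNIV A" using A by (simp add: graded_cif_subspace_def)
    then show "cif_set_on UNIV A" by (simp add: cif_subspace_def)
    \<comment> \<open>The scalar inequality of a CIF subspace, applied with the scalar -1 at
      \<open>- br x y\<close>, removes the sign.\<close>
    have "br x y = scale (- 1) (- br x y)" by simp
    then show "lam A (- br x y) \<le> lam A (br x y)" "rho A (br x y) \<le> rho A (- br x y)"
      using sub unfolding cif_subspace_def by (metis UNIV_I)+
  qed
  have le_image: "lam A (- br x y) \<le> lam ?B (- br' (\<phi> x) (\<phi> y))"
      "rho ?B (- br' (\<phi> x) (\<phi> y)) \<le> rho A (- br x y)"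
    if A: "graded_cif_subspace scale G A" for x y
    using order_trans[OF neg(1)[OF A] lam_le_image[OF assms(4) cif[OF A]]]
      order_trans[OF rho_image_le[OF assms(4) cif[OF A]] neg(2)[OF A]] by (simp_all add: br)
  show ?thesis
  proof (intro conjI impI)
    assume "anti_cif_lie_subsuperalgebra scale G br A"
    then have A: "graded_cif_subspace scale G A"
      and lie: "\<And>x y. inf (lam A x) (lam A y) \<le> lam A (- br x y)"
        "\<And>x y. rho A (- br x y) \<le> sup (rho A x) (rho A y)"
      by (auto simp: anti_cif_lie_subsuperalgebra_def)
    have "inf (lam ?B x) (lam ?B y) \<le> lam ?B (- br' x y)" for x y
      by (rule inf_lam_image_least[OF assms(4) cif[OF A]])
        (use order_trans[OF lie(1) le_image(1)[OF A]] in blast)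
    moreover have "rho ?B (- br' x y) \<le> sup (rho ?B x) (rho ?B y)" for x y
      by (rule sup_rho_image_greatest[OF assms(4) cif[OF A]])
        (use order_trans[OF le_image(2)[OF A] lie(2)] in blast)
    ultimately show "anti_cif_lie_subsuperalgebra scale' G' br' ?B"
      using image[OF A] by (simp add: anti_cif_lie_subsuperalgebra_def)
  next
    assume "anti_cif_ideal scale G br A"
    then have A: "graded_cif_subspace scale G A"
      and lie: "\<And>x y. lam A x \<le> lam A (- br x y)" "\<And>x y. lam A y \<le> lam A (- br x y)"
        "\<And>x y. rho A (- br x y) \<le> rho A x" "\<And>x y. rho A (- br x y) \<le> rho A y"
      by (auto simp: anti_cif_ideal_def)
    have "lam ?B x \<le> lam ?B (- br' x y) \<and> lam ?B y \<le> lam ?B (- br' x y) \<and>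
        rho ?B (- br' x y) \<le> rho ?B x \<and> rho ?B (- br' x y) \<le> rho ?B y" for x y
    proof -
      \<comment> \<open>A bound by a join for \<open>lam\<close>, or a meet for \<open>rho\<close>,
        splits into two bounds in one argument each. So one fibre is traversed at a time, while the
        other argument keeps a fixed preimage.\<close>
      obtain a b where ab: "x = \<phi> a" "y = \<phi> b" using assms(4) by (metis surjD)
      show ?thesis
        using order_trans[OF lie(1) le_image(1)[OF A]] order_trans[OF lie(2) le_image(1)[OF A]]
          order_trans[OF le_image(2)[OF A] lie(3)] order_trans[OF le_image(2)[OF A] lie(4)] ab
        by (intro conjI lam_image_least[OF assms(4) cif[OF A]] rho_image_greatest[OF assms(4) cif[OF A]])
          metis+
    qed
    then show "anti_cif_ideal scale' G' br' ?B"
      using image[OF A] by (simp add: anti_cif_ideal_def)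
  qed
qed

end
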